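(* Let $n,m,\ell$ be integers with $1\leq \ell+1\leq m\leq n$. Let $d\geq 1$ be an integer and $0<p<1$, and let $X_1,X_2,\ldots,X_n$ be i.i.d. binomial random variables with parameter $(d,p)$. Then the maximal correlation coefficient of the two minima is $$R\left(\min_{i:1\leq i\leq m}X_i,\ \min_{j:\ell+1\leq j\leq n}X_j\right)=R_{m,\ell}\bigl(1-(1-p)^d\bigr),$$ where, for $q\in(0,1)$, $$R_{m,\ell}(q):=\frac{q^n-q^{m+n-\ell}}{\sqrt{q^{m+n-\ell}(1-q^m)(1-q^{n-\ell})}}.$$
   Context: For two non-degenerate random variables $X$ and $Y$ on the same probability space, the maximal correlation coefficient is $$R(X,Y)=\sup\frac{\operatorname{Cov}(\varphi(X),\psi(Y))}{\sqrt{\operatorname{Var}(\varphi(X))\operatorname{Var}(\psi(Y))}},$$ where the supremum is over all (real-valued) measurable functions $\varphi$ and $\psi$ such that $\operatorname{Var}(\varphi(X)),\operatorname{Var}(\psi(Y))\in(0,\infty)$. A binomial random variable with parameter $(d,p)$ satisfies $P(X=k)=\binom{d}{k}p^k(1-p)^{d-k}$ for $0\leq k\leq d$. *)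

theory Defs
  imports "HOL-Probability.Probability"
begin

context prob_space
begin

definition covariance :: "('a \<Rightarrow> real) \<Rightarrow> ('a \<Rightarrow> real) \<Rightarrow> real" where
  "covariance U V =
     expectation (\<lambda>\<omega>. (U \<omega> - expectation U) * (V \<omega> - expectation V))"

text \<open>Square-integrability is required explicitly because the Bochner integral of a
  non-integrable function is 0, so positivity of \<open>variance\<close> alone does not express that the
  second moment is finite.\<close>

definition finite_pos_variance :: "('a \<Rightarrow> real) \<Rightarrow> bool" where
  "finite_pos_variance U \<longleftrightarrow>
     U \<in> borel_measurable M \<and> integrable M (\<lambda>\<omega>. (U \<omega>)\<^sup>2) \<and> 0 < variance U"

text \<open>For non-degenerate \<open>X\<close> and \<open>Y\<close> the set below is nonempty, and it is bounded above
  by 1 (Cauchy-Schwarz), so the supremum over the reals is the genuine one. For degenerate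
  \<open>X\<close> or \<open>Y\<close> the set is empty and the value is unspecified.\<close>

definition maximal_correlation :: "('a \<Rightarrow> real) \<Rightarrow> ('a \<Rightarrow> real) \<Rightarrow> real" where
  "maximal_correlation X Y =
     Sup {covariance (\<lambda>\<omega>. \<phi> (X \<omega>)) (\<lambda>\<omega>. \<psi> (Y \<omega>)) /
            sqrt (variance (\<lambda>\<omega>. \<phi> (X \<omega>)) * variance (\<lambda>\<omega>. \<psi> (Y \<omega>)))
          | \<phi> \<psi>. \<phi> \<in> borel_measurable borel \<and> \<psi> \<in> borel_measurable borel \<and>
                 finite_pos_variance (\<lambda>\<omega>. \<phi> (X \<omega>)) \<and> finite_pos_variance (\<lambda>\<omega>. \<psi> (Y \<omega>))}"

text \<open>\<open>X\<close> is real-valued and need only take values in \<open>{0..d}\<close> almost surely, so the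
  binomial law is transported along \<open>real\<close>.\<close>

definition binomial_rv :: "nat \<Rightarrow> real \<Rightarrow> ('a \<Rightarrow> real) \<Rightarrow> bool" where
  "binomial_rv d p X \<longleftrightarrow> random_variable borel X \<and>
     distr M borel X = distr (measure_pmf (binomial_pmf d p)) borel real"

end

text \<open>The traditional notation \<open>R\<^sub>m\<^sub>,\<^sub>l(q)\<close> leaves the dependence on \<open>n\<close> implicit. The natural
  number subtractions are exact for \<open>l \<le> n\<close>.\<close>

definition R_min :: "nat \<Rightarrow> nat \<Rightarrow> nat \<Rightarrow> real \<Rightarrow> real" where
  "R_min n m l q =
     (q ^ n - q ^ (m + n - l)) / sqrt (q ^ (m + n - l) * (1 - q ^ m) * (1 - q ^ (n - l)))"

end

theory Submission
  imports Defs
begin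

text \<open>Let \<open>G k = P(X \<ge> k)\<close>, let \<open>U\<close> and \<open>V\<close> be the minima over \<open>S\<close> and \<open>T\<close>, and put
  \<open>c = |S \<inter> T|\<close>. By independence the indicators of \<open>U \<ge> i\<close> and \<open>V \<ge> j\<close> have covariance
  \<open>G(i)^|S| G(j)^|T| (G(min i j)^(-c) - 1)\<close>, and the last factor telescopes into the sum over
  \<open>k < min i j\<close> of \<open>w k = G(k+1)^(-c) - G(k)^(-c)\<close>. Expanding \<open>\<phi>(U)\<close> and \<open>\<psi>(V)\<close> in these
  indicators gives diagonal forms: the covariance is \<open>\<Sum>k. w k * F k * H k\<close> and the variances
  are \<open>\<Sum>k. u k * (F k)^2\<close> and \<open>\<Sum>k. v k * (H k)^2\<close>, with the same \<open>F\<close> (depending only on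
  \<open>\<phi>\<close>) and \<open>H\<close> (depending only on \<open>\<psi>\<close>), and with \<open>u\<close>, \<open>v\<close> obtained from \<open>w\<close> by replacing \<open>c\<close>
  with \<open>|S|\<close>, \<open>|T|\<close>. By Cauchy-Schwarz the maximal correlation is the largest
  \<open>w k / sqrt (u k * v k)\<close>. It is attained at \<open>k = 0\<close>, because \<open>t^c\<close> is a concave function of
  \<open>t^m\<close> when \<open>c \<le> m\<close>; the extremal functions are the indicators of \<open>U \<ge> 1\<close> and \<open>V \<ge> 1\<close>.\<close>

section \<open>Concavity of powers, telescoping sums and weighted Cauchy-Schwarz\<close>

text \<open>Chord slopes of the concave map from \<open>t ^ m\<close> to \<open>t ^ c\<close>
  decrease to the right. The comparison is cross-multiplied so that degenerate chords,
  \<open>a = b\<close> or \<open>x = y\<close>, are allowed.\<close>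

lemma power_difference_ratio_antimono:
  fixes a b x y :: real
  assumes "0 < a" "a \<le> b" "b \<le> x" "x \<le> y" "0 < c" "c \<le> m"
  shows "(y ^ c - x ^ c) * (b ^ m - a ^ m) \<le> (y ^ m - x ^ m) * (b ^ c - a ^ c)"
proof (cases "a = b \<or> x = y")
  case True
  then show ?thesis by auto
next
  case False
  then have ab: "a < b" and xy: "x < y" using assms by auto
  \<comment> \<open>Cauchy's mean value theorem for the two powers; cancelling
    \<open>\<xi> ^ (c - 1)\<close> leaves a chord slope governed by \<open>\<xi> ^ (m - c)\<close>,
    which is monotone in \<open>\<xi>\<close>.\<close>
  have mvt: "\<exists>\<xi>. u < \<xi> \<and> \<xi> < v \<and>
      (v ^ m - u ^ m) * real c = (v ^ c - u ^ c) * (real m * \<xi> ^ (m - c))"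
    if "0 < u" "u < v" for u v :: real
  proof -
    have "\<exists>\<xi>. \<xi> > u \<and> \<xi> < v \<and>
        (v ^ m - u ^ m) * (real c * \<xi> ^ (c - 1)) = (v ^ c - u ^ c) * (real m * \<xi> ^ (m - 1))"
      by (rule GMVT') (use that in \<open>auto intro!: derivative_eq_intros continuous_intros\<close>)
    then obtain \<xi> where \<xi>: "\<xi> > u" "\<xi> < v"
      and eq: "(v ^ m - u ^ m) * (real c * \<xi> ^ (c - 1)) = (v ^ c - u ^ c) * (real m * \<xi> ^ (m - 1))"
      by blast
    have "m - 1 = (m - c) + (c - 1)" using assms by simp
    then have "\<xi> ^ (m - 1) = \<xi> ^ (m - c) * \<xi> ^ (c - 1)" by (metis power_add)
    then have "((v ^ m - u ^ m) * real c) * \<xi> ^ (c - 1)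
        = ((v ^ c - u ^ c) * (real m * \<xi> ^ (m - c))) * \<xi> ^ (c - 1)"
      using eq by (simp add: mult.assoc)
    moreover have "\<xi> ^ (c - 1) \<noteq> 0" using \<xi> that by simp
    ultimately show ?thesis using \<xi> by (metis mult_right_cancel)
  qed
  obtain \<xi> where \<xi>: "a < \<xi>" "\<xi> < b"
    "(b ^ m - a ^ m) * real c = (b ^ c - a ^ c) * (real m * \<xi> ^ (m - c))"
    using mvt[OF \<open>0 < a\<close> ab] by blast
  obtain \<eta> where \<eta>: "x < \<eta>" "\<eta> < y"
    "(y ^ m - x ^ m) * real c = (y ^ c - x ^ c) * (real m * \<eta> ^ (m - c))"
    using mvt[OF _ xy] assms by force
  have "0 \<le> (y ^ c - x ^ c) * (b ^ c - a ^ c)"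
    using assms by (intro mult_nonneg_nonneg) (auto intro!: power_mono)
  moreover have "real m * \<xi> ^ (m - c) \<le> real m * \<eta> ^ (m - c)"
    using \<xi> \<eta> assms by (intro mult_left_mono power_mono) auto
  ultimately have "((y ^ c - x ^ c) * (b ^ c - a ^ c)) * (real m * \<xi> ^ (m - c))
      \<le> ((y ^ c - x ^ c) * (b ^ c - a ^ c)) * (real m * \<eta> ^ (m - c))"
    by (rule mult_left_mono[rotated])
  then have "((y ^ c - x ^ c) * (b ^ m - a ^ m)) * real c
      \<le> ((y ^ m - x ^ m) * (b ^ c - a ^ c)) * real c"
    using arg_cong[OF \<xi>(3), of "(*) (y ^ c - x ^ c)"] arg_cong[OF \<eta>(3), of "(*) (b ^ c - a ^ c)"]
    by (simp only: mult_ac)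
  then show ?thesis using \<open>0 < c\<close> by simp
qed

text \<open>Used with \<open>N\<close> the value of a minimum: the \<open>of_bool\<close> factors
  then become indicators of tail events.\<close>

lemma sum_step_telescope:
  fixes f :: "nat \<Rightarrow> real"
  assumes "N \<le> d"
  shows "f N = f 0 + (\<Sum>k\<in>{1..d}. (f k - f (k - 1)) * of_bool (k \<le> N))"
proof -
  have "(\<Sum>k\<in>{1..d}. (f k - f (k - 1)) * of_bool (k \<le> N)) = (\<Sum>k\<in>{1..N}. f k - f (k - 1))"
    using assms by (intro sum.mono_neutral_cong_right) auto
  also have "\<dots> = (\<Sum>k<N. f (Suc k) - f k)"
    by (rule sum.reindex_bij_witness[of _ Suc "\<lambda>k. k - 1"]) auto
  finally show ?thesis by (simp add: sum_lessThan_telescope)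
qed

text \<open>The condition \<open>k < min i j\<close> splits into \<open>k < i\<close> and
  \<open>k < j\<close>, so after exchanging the sums the kernel factorises for each fixed
  \<open>k\<close>.\<close>

lemma sum_min_kernel:
  fixes f g w :: "nat \<Rightarrow> real"
  shows "(\<Sum>i\<in>{1..d}. \<Sum>j\<in>{1..d}. f i * g j * (\<Sum>k<min i j. w k))
    = (\<Sum>k<d. w k * (\<Sum>i\<in>{k<..d}. f i) * (\<Sum>j\<in>{k<..d}. g j))"
proof -
  have "(\<Sum>i\<in>{1..d}. \<Sum>j\<in>{1..d}. f i * g j * (\<Sum>k<min i j. w k))
      = (\<Sum>i\<in>{1..d}. \<Sum>j\<in>{1..d}. \<Sum>k<d. w k * (f i * of_bool (k < i)) * (g j * of_bool (k < j)))"
    by (intro sum.cong refl, subst sum_distrib_left, rule sum.mono_neutral_cong_left) auto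
  also have "\<dots> = (\<Sum>i\<in>{1..d}. \<Sum>k<d. \<Sum>j\<in>{1..d}. w k * (f i * of_bool (k < i)) * (g j * of_bool (k < j)))"
    by (intro sum.cong refl sum.swap)
  also have "\<dots> = (\<Sum>k<d. \<Sum>i\<in>{1..d}. \<Sum>j\<in>{1..d}. w k * (f i * of_bool (k < i)) * (g j * of_bool (k < j)))"
    by (rule sum.swap)
  also have "\<dots> = (\<Sum>k<d. w k * (\<Sum>i\<in>{1..d}. f i * of_bool (k < i)) * (\<Sum>j\<in>{1..d}. g j * of_bool (k < j)))"
    by (simp only: mult.assoc sum_product) (simp only: sum_distrib_left)
  also have "\<dots> = (\<Sum>k<d. w k * (\<Sum>i\<in>{k<..d}. f i) * (\<Sum>j\<in>{k<..d}. g j))"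
  proof -
    have "(\<Sum>i\<in>{1..d}. h i * of_bool (k < i)) = (\<Sum>i\<in>{k<..d}. h i)" for h :: "nat \<Rightarrow> real" and k
      by (rule sum.mono_neutral_cong_right) auto
    then show ?thesis by simp
  qed
  finally show ?thesis .
qed

text \<open>The termwise bound on \<open>w\<close> reduces this to the ordinary inequality for the
  vectors \<open>sqrt (u k) * x k\<close> and \<open>sqrt (v k) * y k\<close>.\<close>

lemma weighted_Cauchy_Schwarz:
  fixes u v w x y :: "'b \<Rightarrow> real"
  assumes "\<And>k. k \<in> A \<Longrightarrow> 0 \<le> u k" "\<And>k. k \<in> A \<Longrightarrow> 0 \<le> v k"
    and "\<And>k. k \<in> A \<Longrightarrow> \<bar>w k\<bar> \<le> r * sqrt (u k * v k)" and "0 \<le> r"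
  shows "(\<Sum>k\<in>A. w k * x k * y k) \<le> r * sqrt ((\<Sum>k\<in>A. u k * (x k)\<^sup>2) * (\<Sum>k\<in>A. v k * (y k)\<^sup>2))"
proof -
  have "(\<Sum>k\<in>A. w k * x k * y k)
      \<le> (\<Sum>k\<in>A. r * (\<bar>sqrt (u k) * x k\<bar> * \<bar>sqrt (v k) * y k\<bar>))"
  proof (rule sum_mono)
    fix k assume k: "k \<in> A"
    have "w k * x k * y k \<le> \<bar>w k\<bar> * \<bar>x k * y k\<bar>"
      by (metis abs_ge_self abs_mult mult.assoc)
    also have "\<dots> \<le> r * sqrt (u k * v k) * \<bar>x k * y k\<bar>"
      using assms(3)[OF k] by (rule mult_right_mono) simp
    also have "\<dots> = r * (\<bar>sqrt (u k) * x k\<bar> * \<bar>sqrt (v k) * y k\<bar>)"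
      using assms(1,2)[OF k] by (simp add: real_sqrt_mult abs_mult mult_ac)
    finally show "w k * x k * y k \<le> r * (\<bar>sqrt (u k) * x k\<bar> * \<bar>sqrt (v k) * y k\<bar>)" .
  qed
  also have "\<dots> = r * (\<Sum>k\<in>A. \<bar>sqrt (u k) * x k\<bar> * \<bar>sqrt (v k) * y k\<bar>)"
    by (simp add: sum_distrib_left)
  also have "\<dots> \<le> r * (L2_set (\<lambda>k. sqrt (u k) * x k) A * L2_set (\<lambda>k. sqrt (v k) * y k) A)"
    by (rule mult_left_mono[OF L2_set_mult_ineq assms(4)])
  also have "\<dots> = r * sqrt ((\<Sum>k\<in>A. u k * (x k)\<^sup>2) * (\<Sum>k\<in>A. v k * (y k)\<^sup>2))"
    unfolding L2_set_def real_sqrt_mult using assms(1,2)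
    by (simp add: power_mult_distrib)
  finally show ?thesis .
qed

section \<open>Minima of i.i.d. variables with values in {0..d}\<close>

text \<open>Only the common tail function \<open>G\<close> of the law enters the argument. Its
  positivity is asked up to \<open>d\<close> because, for nonempty \<open>I\<close>, the tail at
  \<open>d + 1\<close> vanishes; reciprocals of \<open>G\<close> are therefore used only up to index
  \<open>d\<close>.\<close>

locale iid_bounded_nat = prob_space +
  fixes X :: "'i \<Rightarrow> 'a \<Rightarrow> real" and I :: "'i set" and d :: nat and G :: "nat \<Rightarrow> real"
  assumes indep: "indep_vars (\<lambda>_. borel) X I"
    and range_X: "\<And>i. i \<in> I \<Longrightarrow> AE \<omega> in M. X i \<omega> \<in> real ` {..d}"
    and tail: "\<And>i k. i \<in> I \<Longrightarrow> prob {\<omega> \<in> space M. real k \<le> X i \<omega>} = G k"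
    and antimono_G: "antimono G"
    and G_0: "G 0 = 1"
    and G_pos: "\<And>k. k \<le> d \<Longrightarrow> 0 < G k"
begin

definition minimum :: "'i set \<Rightarrow> 'a \<Rightarrow> real" where
  "minimum S \<omega> = (MIN i\<in>S. X i \<omega>)"

definition tail_event :: "'i set \<Rightarrow> nat \<Rightarrow> 'a set" where
  "tail_event S k = {\<omega> \<in> space M. real k \<le> minimum S \<omega>}"

definition increment :: "nat \<Rightarrow> nat \<Rightarrow> real" where
  "increment c k = (1 / G (Suc k)) ^ c - (1 / G k) ^ c"

text \<open>These are the sums \<open>F\<close> and \<open>H\<close> of the diagonal forms. The
  weight \<open>G i ^ c\<close> is the part of the indicator covariance that depends on one
  threshold only. All indices \<open>i\<close> are positive, so \<open>i - 1\<close> is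
  exact.\<close>

definition tail_sum :: "nat \<Rightarrow> (real \<Rightarrow> real) \<Rightarrow> nat \<Rightarrow> real" where
  "tail_sum c \<phi> k = (\<Sum>i\<in>{k<..d}. (\<phi> (real i) - \<phi> (real (i - 1))) * G i ^ c)"

lemma measurable_X [measurable]: "i \<in> I \<Longrightarrow> X i \<in> borel_measurable M"
  using indep unfolding indep_vars_def by simp

lemma tail_event_eq:
  assumes "finite S" "S \<noteq> {}"
  shows "tail_event S k = {\<omega> \<in> space M. \<forall>i\<in>S. real k \<le> X i \<omega>}"
  unfolding tail_event_def minimum_def using assms by (simp add: Min_ge_iff)

lemma measurable_minimum:
  assumes "finite S" "S \<noteq> {}" "S \<subseteq> I"
  shows "minimum S \<in> borel_measurable M"
  unfolding minimum_def using assms by (intro borel_measurable_Min) auto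

lemma tail_event_sets [measurable]:
  assumes "finite S" "S \<noteq> {}" "S \<subseteq> I"
  shows "tail_event S k \<in> sets M"
proof -
  note measurable_minimum[OF assms, measurable]
  show ?thesis unfolding tail_event_def by measurable
qed

lemma minimum_values:
  assumes "finite S" "S \<noteq> {}" "S \<subseteq> I"
  shows "AE \<omega> in M. minimum S \<omega> \<in> real ` {..d}"
proof -
  have "AE \<omega> in M. \<forall>i\<in>S. X i \<omega> \<in> real ` {..d}"
    using assms range_X by (intro AE_finite_allI) auto
  then show ?thesis
  proof eventually_elim
    case (elim \<omega>)
    have "Min ((\<lambda>i. X i \<omega>) ` S) \<in> (\<lambda>i. X i \<omega>) ` S" using assms by (intro Min_in) auto
    then show ?case using elim unfolding minimum_def by auto
  qed
qed

text \<open>A variable indexed by \<open>S \<inter> T\<close> must reach \<open>max i j\<close>, and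
  \<open>G (max i j) * G (min i j) = G i * G j\<close>. This restores the full marginal powers and
  leaves a correction in \<open>min i j\<close> alone.\<close>

lemma prob_tail_events:
  assumes S: "finite S" "S \<noteq> {}" "S \<subseteq> I" and T: "finite T" "T \<noteq> {}" "T \<subseteq> I"
    and ij: "i \<le> d" "j \<le> d"
  shows "prob (tail_event S i \<inter> tail_event T j)
    = G i ^ card S * G j ^ card T * (1 / G (min i j)) ^ card (S \<inter> T)"
proof -
  \<comment> \<open>The threshold for \<open>X t\<close>; the value 0 is neutral for
    \<open>max\<close> and stands for no constraint from a set not containing
    \<open>t\<close>.\<close>
  define e where "e t = max (if t \<in> S then i else 0) (if t \<in> T then j else 0)" for t
  have "tail_event S i \<inter> tail_event T j = (\<Inter>t\<in>S \<union> T. X t -` {real (e t)..} \<inter> space M)"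
    unfolding tail_event_eq[OF S(1,2)] tail_event_eq[OF T(1,2)] e_def
    using S(2) by (auto simp: max_def split: if_splits)
  then have "prob (tail_event S i \<inter> tail_event T j)
      = (\<Prod>t\<in>S \<union> T. prob (X t -` {real (e t)..} \<inter> space M))"
    using indep_varsD[OF indep, of "S \<union> T" "\<lambda>t. {real (e t)..}"] S T by auto
  also have "\<dots> = (\<Prod>t\<in>S \<union> T. G (e t))"
  proof (rule prod.cong[OF refl])
    fix t assume "t \<in> S \<union> T"
    then have "t \<in> I" using S T by auto
    have "X t -` {real (e t)..} \<inter> space M = {\<omega> \<in> space M. real (e t) \<le> X t \<omega>}" by auto
    then show "prob (X t -` {real (e t)..} \<inter> space M) = G (e t)"
      using tail[OF \<open>t \<in> I\<close>] by simp
  qed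
  also have "S \<union> T = (S - T) \<union> ((T - S) \<union> (S \<inter> T))" by auto
  also have "(\<Prod>t\<in>\<dots>. G (e t)) = (\<Prod>t\<in>S - T. G (e t)) * ((\<Prod>t\<in>T - S. G (e t)) * (\<Prod>t\<in>S \<inter> T. G (e t)))"
    using S T by (subst prod.union_disjoint; (subst prod.union_disjoint)?) auto
  also have "\<dots> = G i ^ card (S - T) * (G j ^ card (T - S) * G (max i j) ^ card (S \<inter> T))"
    unfolding e_def by simp
  also have "G (max i j) ^ card (S \<inter> T) = G i ^ card (S \<inter> T) * G j ^ card (S \<inter> T) * (1 / G (min i j)) ^ card (S \<inter> T)"
    using G_pos[OF ij(1)] G_pos[OF ij(2)]
    by (auto simp: max_def min_def simp flip: power_mult_distrib)
  finally have "prob (tail_event S i \<inter> tail_event T j)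
      = G i ^ (card (S - T) + card (S \<inter> T)) * G j ^ (card (T - S) + card (S \<inter> T))
        * (1 / G (min i j)) ^ card (S \<inter> T)"
    by (simp add: power_add mult_ac)
  moreover have "card (S - T) + card (S \<inter> T) = card S" "card (T - S) + card (S \<inter> T) = card T"
    using S T by (metis card_Diff_subset_Int card_mono finite_Int inf_le1 le_add_diff_inverse2)
      (use S T in \<open>metis card_Diff_subset_Int card_mono finite_Int inf_commute inf_le1 le_add_diff_inverse2\<close>)
  ultimately show ?thesis by simp
qed

lemma prob_tail_event:
  assumes "finite S" "S \<noteq> {}" "S \<subseteq> I" "i \<le> d"
  shows "prob (tail_event S i) = G i ^ card S"
  using prob_tail_events[OF assms(1-3) assms(1-3) assms(4) assms(4)] G_pos[OF assms(4)]
  by (simp add: power_divide)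

lemma sum_increment: "(\<Sum>k<N. increment c k) = (1 / G N) ^ c - 1"
  unfolding increment_def using sum_lessThan_telescope[of "\<lambda>k. (1 / G k) ^ c" N] G_0 by simp

section \<open>Diagonal forms of covariance and variance\<close>

text \<open>A minimum takes finitely many values almost surely, so any centred function of it is a
  finite combination of centred tail indicators. Bilinearity then leaves the covariances of these
  indicators, a kernel in \<open>min i j\<close>.\<close>

lemma covariance_minimum:
  assumes S: "finite S" "S \<noteq> {}" "S \<subseteq> I" and T: "finite T" "T \<noteq> {}" "T \<subseteq> I"
    and [measurable]: "\<phi> \<in> borel_measurable borel" "\<psi> \<in> borel_measurable borel"
  shows "covariance (\<lambda>\<omega>. \<phi> (minimum S \<omega>)) (\<lambda>\<omega>. \<psi> (minimum T \<omega>))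
    = (\<Sum>k<d. increment (card (S \<inter> T)) k * tail_sum (card S) \<phi> k * tail_sum (card T) \<psi> k)"
proof -
  define Z where "Z R i \<omega> = indicator (tail_event R i) \<omega> - G i ^ card R" for R i and \<omega> :: 'a
  define \<delta> where "\<delta> \<theta> i = \<theta> (real i) - \<theta> (real (i - 1))" for \<theta> :: "real \<Rightarrow> real" and i
  have centred: "AE \<omega> in M. \<theta> (minimum R \<omega>) - expectation (\<lambda>\<omega>. \<theta> (minimum R \<omega>))
        = (\<Sum>i\<in>{1..d}. \<delta> \<theta> i * Z R i \<omega>)"
    if R: "finite R" "R \<noteq> {}" "R \<subseteq> I" and [measurable]: "\<theta> \<in> borel_measurable borel" for R \<theta>
  proof -
    note [measurable] = measurable_minimum[OF R] tail_event_sets[OF R]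
    have expand: "AE \<omega> in M. \<theta> (minimum R \<omega>)
        = \<theta> 0 + (\<Sum>i\<in>{1..d}. \<delta> \<theta> i * indicator (tail_event R i) \<omega>)"
      using minimum_values[OF R] AE_space
    proof eventually_elim
      case (elim \<omega>)
      then obtain N where N: "N \<le> d" "minimum R \<omega> = real N" by auto
      have "indicator (tail_event R i) \<omega> = (of_bool (i \<le> N) :: real)" for i
        using N elim by (simp add: tail_event_def)
      then show ?case
        using sum_step_telescope[OF N(1), of "\<lambda>k. \<theta> (real k)"] N by (simp add: \<delta>_def)
    qed
    have "expectation (\<lambda>\<omega>. \<theta> (minimum R \<omega>))
        = expectation (\<lambda>\<omega>. \<theta> 0 + (\<Sum>i\<in>{1..d}. \<delta> \<theta> i * indicator (tail_event R i) \<omega>))"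
      by (rule integral_cong_AE[OF _ _ expand]) measurable
    also have "\<dots> = \<theta> 0 + (\<Sum>i\<in>{1..d}. \<delta> \<theta> i * G i ^ card R)"
      using R tail_event_sets[OF R]
      by (simp add: prob_space prob_tail_event less_top[symmetric] del: sum_mult_indicator)
    finally have mean: "expectation (\<lambda>\<omega>. \<theta> (minimum R \<omega>))
        = \<theta> 0 + (\<Sum>i\<in>{1..d}. \<delta> \<theta> i * G i ^ card R)" .
    show ?thesis
      using expand unfolding mean
      by eventually_elim (simp add: Z_def sum_subtractf right_diff_distrib del: sum_mult_indicator)
  qed
  note [measurable] = measurable_minimum[OF S] tail_event_sets[OF S]
    measurable_minimum[OF T] tail_event_sets[OF T]
  \<comment> \<open>Subtracting the product of the marginals turns the correction factor into
    \<open>(1 / G (min i j)) ^ card (S \<inter> T) - 1\<close>, which is the telescoped sum because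
    \<open>G 0 = 1\<close>.\<close>
  have kernel: "integrable M (\<lambda>\<omega>. Z S i \<omega> * Z T j \<omega>)"
    "expectation (\<lambda>\<omega>. Z S i \<omega> * Z T j \<omega>)
        = G i ^ card S * G j ^ card T * (\<Sum>k<min i j. increment (card (S \<inter> T)) k)"
    if ij: "i \<le> d" "j \<le> d" for i j
  proof -
    have eq: "Z S i \<omega> * Z T j \<omega> = indicator (tail_event S i \<inter> tail_event T j) \<omega>
        - G j ^ card T * indicator (tail_event S i) \<omega> - G i ^ card S * indicator (tail_event T j) \<omega>
        + G i ^ card S * G j ^ card T" for \<omega>
      unfolding Z_def indicator_inter_arith by (simp add: algebra_simps)
    show "integrable M (\<lambda>\<omega>. Z S i \<omega> * Z T j \<omega>)"
      unfolding eq using tail_event_sets[OF S] tail_event_sets[OF T] by (simp add: less_top[symmetric])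
    have "expectation (\<lambda>\<omega>. Z S i \<omega> * Z T j \<omega>)
        = prob (tail_event S i \<inter> tail_event T j) - G j ^ card T * prob (tail_event S i)
          - G i ^ card S * prob (tail_event T j) + G i ^ card S * G j ^ card T"
      unfolding eq using tail_event_sets[OF S] tail_event_sets[OF T]
      by (simp add: prob_space less_top[symmetric])
    then show "expectation (\<lambda>\<omega>. Z S i \<omega> * Z T j \<omega>)
        = G i ^ card S * G j ^ card T * (\<Sum>k<min i j. increment (card (S \<inter> T)) k)"
      unfolding prob_tail_events[OF S T ij] prob_tail_event[OF S ij(1)]
        prob_tail_event[OF T ij(2)] sum_increment
      by (simp add: algebra_simps)
  qed
  have "covariance (\<lambda>\<omega>. \<phi> (minimum S \<omega>)) (\<lambda>\<omega>. \<psi> (minimum T \<omega>))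
      = expectation (\<lambda>\<omega>. \<Sum>i\<in>{1..d}. \<Sum>j\<in>{1..d}. \<delta> \<phi> i * \<delta> \<psi> j * (Z S i \<omega> * Z T j \<omega>))"
    unfolding covariance_def
  proof (rule integral_cong_AE)
    show "AE \<omega> in M. (\<phi> (minimum S \<omega>) - expectation (\<lambda>\<omega>. \<phi> (minimum S \<omega>)))
          * (\<psi> (minimum T \<omega>) - expectation (\<lambda>\<omega>. \<psi> (minimum T \<omega>)))
        = (\<Sum>i\<in>{1..d}. \<Sum>j\<in>{1..d}. \<delta> \<phi> i * \<delta> \<psi> j * (Z S i \<omega> * Z T j \<omega>))"
      using centred[OF S assms(7)] centred[OF T assms(8)]
    proof eventually_elim
      case (elim \<omega>)
      show ?case unfolding elim by (simp add: sum_product mult_ac)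
    qed
  qed (auto simp: Z_def)
  also have "\<dots> = (\<Sum>i\<in>{1..d}. \<Sum>j\<in>{1..d}. \<delta> \<phi> i * \<delta> \<psi> j
      * (G i ^ card S * G j ^ card T * (\<Sum>k<min i j. increment (card (S \<inter> T)) k)))"
  proof -
    have int: "integrable M (\<lambda>\<omega>. \<delta> \<phi> i * \<delta> \<psi> j * (Z S i \<omega> * Z T j \<omega>))"
      if "i \<in> {1..d}" "j \<in> {1..d}" for i j
      using that by (intro integrable_mult_right kernel(1)) auto
    show ?thesis
      by (subst Bochner_Integration.integral_sum, intro Bochner_Integration.integrable_sum int,
          assumption+, intro sum.cong refl, subst Bochner_Integration.integral_sum, rule int,
          assumption+, intro sum.cong refl) (simp add: kernel(2))
  qed
  also have "\<dots> = (\<Sum>i\<in>{1..d}. \<Sum>j\<in>{1..d}. (\<delta> \<phi> i * G i ^ card S) * (\<delta> \<psi> j * G j ^ card T)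
      * (\<Sum>k<min i j. increment (card (S \<inter> T)) k))"
    by (simp add: mult_ac)
  also have "\<dots> = (\<Sum>k<d. increment (card (S \<inter> T)) k * tail_sum (card S) \<phi> k * tail_sum (card T) \<psi> k)"
    unfolding sum_min_kernel tail_sum_def \<delta>_def ..
  finally show ?thesis .
qed

text \<open>The covariance formula with \<open>T = S\<close>: the intersection becomes
  \<open>S\<close>, so all exponents agree.\<close>

lemma variance_minimum:
  assumes "finite S" "S \<noteq> {}" "S \<subseteq> I" "\<phi> \<in> borel_measurable borel"
  shows "variance (\<lambda>\<omega>. \<phi> (minimum S \<omega>))
    = (\<Sum>k<d. increment (card S) k * (tail_sum (card S) \<phi> k)\<^sup>2)"
  using covariance_minimum[OF assms(1-3) assms(1-3) assms(4) assms(4)]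
  by (simp add: covariance_def power2_eq_square mult.assoc)

section \<open>The maximal correlation of two minima\<close>

lemma increment_nonneg:
  assumes "k < d" shows "0 \<le> increment c k"
proof -
  have "G (Suc k) \<le> G k" using antimono_G by (simp add: antimonoD)
  then show ?thesis
    unfolding increment_def using G_pos[of "Suc k"] G_pos[of k] assms
    by (auto intro!: power_mono divide_left_mono)
qed

text \<open>For \<open>k > 0\<close> this is the chord comparison at the points
  \<open>1 / G 0\<close>, \<open>1 / G 1\<close>, \<open>1 / G k\<close>,
  \<open>1 / G (Suc k)\<close>, which are ordered as \<open>G\<close> decreases. For
  \<open>k = 0\<close> both sides coincide.\<close>

lemma increment_ratio_le:
  assumes "k < d" "0 < c" "c \<le> e"
  shows "increment c k * increment e 0 \<le> increment e k * increment c 0"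
proof (cases k)
  case (Suc k')
  have mono: "1 / G i \<le> 1 / G j" if "i \<le> j" "j \<le> d" for i j
    using antimonoD[OF antimono_G that(1)] G_pos[of j] G_pos[of i] that
    by (intro divide_left_mono) auto
  show ?thesis
    unfolding increment_def using assms Suc G_pos[of 0]
    by (intro power_difference_ratio_antimono mono) auto
qed (simp add: mult.commute)

text \<open>The overlap makes the exponent \<open>card (S \<inter> T)\<close> positive, as the chord
  comparison requires, and \<open>0 < G 1 < 1\<close> makes the extremal indicators
  non-degenerate.\<close>

theorem maximal_correlation_minimum:
  assumes S: "finite S" "S \<subseteq> I" and T: "finite T" "T \<subseteq> I" and ST: "S \<inter> T \<noteq> {}"
    and d: "0 < d" and G1: "G 1 < 1"
  shows "maximal_correlation (minimum S) (minimum T)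
    = increment (card (S \<inter> T)) 0 / sqrt (increment (card S) 0 * increment (card T) 0)"
    (is "_ = ?\<rho>")
proof -
  let ?c = "card (S \<inter> T)"
  have ne: "S \<noteq> {}" "T \<noteq> {}" using ST by auto
  note S' = S(1) ne(1) S(2) and T' = T(1) ne(2) T(2)
  have c: "0 < ?c" "?c \<le> card S" "?c \<le> card T"
    using S T ST by (auto intro: card_mono simp: card_gt_0_iff)
  have pos: "0 < increment e 0" if "0 < e" for e
    unfolding increment_def using G_0 G1 G_pos[of 1] d that by (simp add: one_less_power)
  have pos': "0 < increment (card S) 0" "0 < increment (card T) 0" "0 < increment ?c 0"
    using pos c by auto
  \<comment> \<open>Among the steps from \<open>i - 1\<close> to \<open>i\<close>, this function
    jumps only at \<open>i = 1\<close>. Hence only the term \<open>k = 0\<close> survives in the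
    diagonal forms, and the quotient is exactly the ratio at \<open>k = 0\<close>.\<close>
  define \<theta> :: "real \<Rightarrow> real" where "\<theta> = indicator {1..}"
  have \<theta>: "\<theta> \<in> borel_measurable borel" unfolding \<theta>_def by simp
  have tail_\<theta>: "tail_sum e \<theta> k = of_bool (k = 0) * G 1 ^ e" if "k < d" for e k
  proof -
    have "\<theta> (real i) - \<theta> (real (i - 1)) = of_bool (i = 1)" if "0 < i" for i
      using that unfolding \<theta>_def by (cases "i = 1") (auto simp: indicator_def)
    then have "tail_sum e \<theta> k = (\<Sum>i\<in>{k<..d}. of_bool (i = 1) * G i ^ e)"
      unfolding tail_sum_def by (intro sum.cong) auto
    also have "\<dots> = (\<Sum>i\<in>{k<..d}. if i = 1 then G 1 ^ e else 0)" by (intro sum.cong) auto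
    also have "\<dots> = of_bool (k = 0) * G 1 ^ e" using that by (subst sum.delta) auto
    finally show ?thesis .
  qed
  have "(\<Sum>k<d. increment e k * tail_sum a \<theta> k * tail_sum b \<theta> k)
      = (\<Sum>k<d. if k = 0 then increment e 0 * G 1 ^ a * G 1 ^ b else 0)" for e a b
    by (intro sum.cong) (auto simp: tail_\<theta>)
  then have sum_\<theta>: "(\<Sum>k<d. increment e k * tail_sum a \<theta> k * tail_sum b \<theta> k)
      = increment e 0 * G 1 ^ a * G 1 ^ b" for e a b
    using d by simp
  have cov_\<theta>: "covariance (\<lambda>\<omega>. \<theta> (minimum S \<omega>)) (\<lambda>\<omega>. \<theta> (minimum T \<omega>))
      = increment ?c 0 * G 1 ^ card S * G 1 ^ card T"
    using covariance_minimum[OF S' T' \<theta> \<theta>] sum_\<theta> by simp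
  have var_\<theta>: "variance (\<lambda>\<omega>. \<theta> (minimum R \<omega>)) = increment (card R) 0 * (G 1 ^ card R)\<^sup>2"
    if "finite R" "R \<noteq> {}" "R \<subseteq> I" for R
    using variance_minimum[OF that \<theta>] sum_\<theta>[of "card R" "card R" "card R"]
    by (simp add: power2_eq_square mult.assoc)
  have finite_\<theta>: "finite_pos_variance (\<lambda>\<omega>. \<theta> (minimum R \<omega>))"
    if R: "finite R" "R \<noteq> {}" "R \<subseteq> I" for R
  proof -
    note [measurable] = measurable_minimum[OF R] \<theta>
    have "integrable M (\<lambda>\<omega>. (\<theta> (minimum R \<omega>))\<^sup>2)"
      by (rule integrable_const_bound[where B = 1]) (auto simp: \<theta>_def indicator_def)
    moreover have "0 < variance (\<lambda>\<omega>. \<theta> (minimum R \<omega>))"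
      unfolding var_\<theta>[OF R] using pos[of "card R"] G_pos[of 1] d R by (simp add: card_gt_0_iff)
    ultimately show ?thesis unfolding finite_pos_variance_def by simp
  qed
  have attained: "covariance (\<lambda>\<omega>. \<theta> (minimum S \<omega>)) (\<lambda>\<omega>. \<theta> (minimum T \<omega>))
      / sqrt (variance (\<lambda>\<omega>. \<theta> (minimum S \<omega>)) * variance (\<lambda>\<omega>. \<theta> (minimum T \<omega>))) = ?\<rho>"
    unfolding cov_\<theta> var_\<theta>[OF S'] var_\<theta>[OF T'] using G_pos[of 1] d
    by (simp add: real_sqrt_mult)
  have "?\<rho> \<ge> 0" using pos' by simp
  have bound: "covariance (\<lambda>\<omega>. \<phi> (minimum S \<omega>)) (\<lambda>\<omega>. \<psi> (minimum T \<omega>))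
      / sqrt (variance (\<lambda>\<omega>. \<phi> (minimum S \<omega>)) * variance (\<lambda>\<omega>. \<psi> (minimum T \<omega>))) \<le> ?\<rho>"
    if [measurable]: "\<phi> \<in> borel_measurable borel" "\<psi> \<in> borel_measurable borel"
      and fin: "finite_pos_variance (\<lambda>\<omega>. \<phi> (minimum S \<omega>))"
        "finite_pos_variance (\<lambda>\<omega>. \<psi> (minimum T \<omega>))" for \<phi> \<psi>
  proof -
    have "\<bar>increment ?c k\<bar> \<le> ?\<rho> * sqrt (increment (card S) k * increment (card T) k)"
      if k: "k < d" for k
    proof -
      \<comment> \<open>The ratio inequalities for the exponents \<open>card S\<close> and
        \<open>card T\<close> multiply to the square of the required bound; nonnegativity then
        permits taking roots.\<close>
      have "(increment ?c k * increment (card S) 0) * (increment ?c k * increment (card T) 0)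
          \<le> (increment (card S) k * increment ?c 0) * (increment (card T) k * increment ?c 0)"
        using pos' increment_nonneg[OF k]
        by (intro mult_mono[OF increment_ratio_le[OF k c(1,2)] increment_ratio_le[OF k c(1,3)]]) auto
      then have "sqrt ((increment ?c k)\<^sup>2 * (increment (card S) 0 * increment (card T) 0))
          \<le> sqrt ((increment ?c 0)\<^sup>2 * (increment (card S) k * increment (card T) k))"
        by (simp add: power2_eq_square mult_ac)
      then have "increment ?c k * sqrt (increment (card S) 0 * increment (card T) 0)
          \<le> increment ?c 0 * sqrt (increment (card S) k * increment (card T) k)"
        using pos' increment_nonneg[OF k] by (simp add: real_sqrt_mult)
      then show ?thesis
        using pos' increment_nonneg[OF k] by (simp add: pos_le_divide_eq)
    qed
    then have "covariance (\<lambda>\<omega>. \<phi> (minimum S \<omega>)) (\<lambda>\<omega>. \<psi> (minimum T \<omega>))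
        \<le> ?\<rho> * sqrt (variance (\<lambda>\<omega>. \<phi> (minimum S \<omega>)) * variance (\<lambda>\<omega>. \<psi> (minimum T \<omega>)))"
      unfolding covariance_minimum[OF S' T' that(1,2)]
        variance_minimum[OF S' that(1)] variance_minimum[OF T' that(2)]
      using \<open>?\<rho> \<ge> 0\<close> by (intro weighted_Cauchy_Schwarz increment_nonneg) auto
    moreover have "0 < sqrt (variance (\<lambda>\<omega>. \<phi> (minimum S \<omega>)) * variance (\<lambda>\<omega>. \<psi> (minimum T \<omega>)))"
      using fin unfolding finite_pos_variance_def by simp
    ultimately show ?thesis by (simp add: pos_divide_le_eq)
  qed
  show ?thesis
    unfolding maximal_correlation_def
  \<comment> \<open>Exhibiting a greatest element settles nonemptiness and boundedness of the set as
    well.\<close>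
  proof (rule cSup_eq_maximum)
    show "?\<rho> \<in> {covariance (\<lambda>\<omega>. \<phi> (minimum S \<omega>)) (\<lambda>\<omega>. \<psi> (minimum T \<omega>)) /
            sqrt (variance (\<lambda>\<omega>. \<phi> (minimum S \<omega>)) * variance (\<lambda>\<omega>. \<psi> (minimum T \<omega>)))
          | \<phi> \<psi>. \<phi> \<in> borel_measurable borel \<and> \<psi> \<in> borel_measurable borel \<and>
              finite_pos_variance (\<lambda>\<omega>. \<phi> (minimum S \<omega>)) \<and> finite_pos_variance (\<lambda>\<omega>. \<psi> (minimum T \<omega>))}"
      using attained[symmetric] \<theta> finite_\<theta>[OF S'] finite_\<theta>[OF T'] by blast
  qed (use bound in blast)
qed

end

section \<open>The binomial case and the closed formula\<close>

text \<open>The right-hand side is what the increments at \<open>k = 0\<close> give when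
  \<open>G 0 = 1\<close> and \<open>G 1 = q\<close>.\<close>

lemma R_min_eq:
  assumes "0 < q" "q < 1" "l < m" "m \<le> n"
  shows "R_min n m l q = ((1 / q) ^ (m - l) - 1) / sqrt (((1 / q) ^ m - 1) * ((1 / q) ^ (n - l) - 1))"
proof -
  have pow: "0 < q ^ k" for k using assms by simp
  have lt: "q ^ m < 1" "q ^ (n - l) < 1" using assms by (auto intro!: power_less_one_iff[THEN iffD2])
  define D where "D = sqrt ((1 - q ^ m) * (1 - q ^ (n - l)))"
  define Q where "Q = sqrt (q ^ (m + n - l))"
  have D: "0 < D" and Q: "0 < Q" unfolding D_def Q_def using pow lt by auto
  have QQ: "Q * Q = q ^ (m + n - l)" unfolding Q_def using pow by (simp add: less_imp_le)
  \<comment> \<open>The first splitting distributes the power of \<open>q\<close> over the two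
    factors under the root; the second factors the numerator.\<close>
  have e: "m + n - l = m + (n - l)" "m + n - l = n + (m - l)" using assms by auto
  have num: "q ^ n - q ^ (m + n - l) = q ^ n * (1 - q ^ (m - l))"
    unfolding e(2) by (simp add: power_add algebra_simps)
  have "R_min n m l q = q ^ n * (1 - q ^ (m - l)) / (Q * D)"
    unfolding R_min_def num D_def Q_def by (simp add: real_sqrt_mult mult.assoc)
  also have "\<dots> = (1 - q ^ (m - l)) / q ^ (m - l) / (D / Q)"
  proof -
    have "q ^ n = Q * Q / q ^ (m - l)"
      unfolding QQ e(2) power_add using assms by simp
    then show ?thesis using D Q assms(1) by (simp add: field_simps)
  qed
  also have "D / Q = sqrt (((1 / q) ^ m - 1) * ((1 / q) ^ (n - l) - 1))"
    unfolding D_def Q_def e(1) power_add real_sqrt_divide[symmetric]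
    using assms by (intro arg_cong[where f = sqrt]) (simp add: power_one_over field_simps)
  also have "(1 - q ^ (m - l)) / q ^ (m - l) = (1 / q) ^ (m - l) - 1"
    using assms by (simp add: power_one_over field_simps)
  finally show ?thesis .
qed

text \<open>The hypothesis equates two laws on the reals, so range and tails are read off there and
  pulled back to both spaces.\<close>

lemma iid_bounded_nat_binomial:
  fixes M :: "'a measure" and X :: "'i \<Rightarrow> 'a \<Rightarrow> real"
  assumes "prob_space M" and p: "0 < p" "p < 1"
    and "prob_space.indep_vars M (\<lambda>_. borel) X I"
    and bin: "\<And>i. i \<in> I \<Longrightarrow> prob_space.binomial_rv M d p (X i)"
  shows "iid_bounded_nat M X I d (\<lambda>k. measure_pmf.prob (binomial_pmf d p) {k..})"
proof -
  interpret prob_space M by fact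
  let ?B = "binomial_pmf d p"
  have meas: "X i \<in> borel_measurable M"
    and law: "distr M borel (X i) = distr (measure_pmf ?B) borel real" if "i \<in> I" for i
    using bin[OF that] unfolding binomial_rv_def by auto
  show ?thesis
  proof
    fix i assume i: "i \<in> I"
    note [measurable] = meas[OF i]
    have [measurable]: "real ` {..d} \<in> sets borel" by (intro borel_closed finite_imp_closed) simp
    have "AE x in measure_pmf ?B. real x \<in> real ` {..d}"
      using set_pmf_binomial_eq[of p d] p by (auto simp: AE_measure_pmf_iff)
    then have "AE x in distr (measure_pmf ?B) borel real. x \<in> real ` {..d}"
      by (subst AE_distr_iff) auto
    then show "AE \<omega> in M. X i \<omega> \<in> real ` {..d}"
      unfolding law[OF i, symmetric] by (subst (asm) AE_distr_iff) auto
    fix k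
    have "prob {\<omega> \<in> space M. real k \<le> X i \<omega>} = measure (distr M borel (X i)) {real k..}"
      by (subst measure_distr) (auto intro!: arg_cong[where f = prob])
    also have "\<dots> = measure_pmf.prob ?B {k..}"
      unfolding law[OF i] by (subst measure_distr) (auto intro!: arg_cong[where f = "measure_pmf.prob ?B"])
    finally show "prob {\<omega> \<in> space M. real k \<le> X i \<omega>} = measure_pmf.prob ?B {k..}" .
  next
    show "antimono (\<lambda>k. measure_pmf.prob ?B {k..})"
      by (intro antimonoI measure_pmf.finite_measure_mono) auto
  next
    show "measure_pmf.prob ?B {0..} = 1" by (simp add: atLeast_0)
  next
    fix k assume "k \<le> d"
    \<comment> \<open>The atom at \<open>d\<close> has mass \<open>p ^ d\<close> and lies in every
      tail with \<open>k \<le> d\<close>.\<close>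
    have "0 < pmf ?B d" using p by simp
    also have "\<dots> = measure_pmf.prob ?B {d}" by (simp add: measure_pmf_single)
    also have "\<dots> \<le> measure_pmf.prob ?B {k..}"
      using \<open>k \<le> d\<close> by (intro measure_pmf.finite_measure_mono) auto
    finally show "0 < measure_pmf.prob ?B {k..}" .
  qed fact
qed

theorem theorem1p5:
  fixes M :: "'a measure" and X :: "nat \<Rightarrow> 'a \<Rightarrow> real"
    and n m l d :: nat and p :: real
  assumes "prob_space M"
    and "1 \<le> l + 1" and "l + 1 \<le> m" and "m \<le> n"
    and "1 \<le> d" and "0 < p" and "p < 1"
    and "prob_space.indep_vars M (\<lambda>_. borel) X {1..n}"
    and "\<And>i. i \<in> {1..n} \<Longrightarrow> prob_space.binomial_rv M d p (X i)"
  shows "prob_space.maximal_correlation M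
           (\<lambda>\<omega>. MIN i\<in>{1..m}. X i \<omega>) (\<lambda>\<omega>. MIN j\<in>{l+1..n}. X j \<omega>)
         = R_min n m l (1 - (1 - p) ^ d)"
proof -
  define G where "G k = measure_pmf.prob (binomial_pmf d p) {k..}" for k
  interpret iid_bounded_nat M X "{1..n}" d G
    unfolding G_def using assms by (intro iid_bounded_nat_binomial)
  \<comment> \<open>The parameter \<open>q\<close> of the closed formula is \<open>G 1\<close>, the
    probability of a nonzero value; the atom at 0 has mass \<open>(1 - p) ^ d\<close>.\<close>
  have "{1..} = - {0::nat}" by auto
  then have "G 1 = 1 - pmf (binomial_pmf d p) 0"
    unfolding G_def using measure_pmf.prob_compl[of "{0}" "binomial_pmf d p"]
    by (simp add: Compl_eq_Diff_UNIV measure_pmf_single)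
  then have G1: "G 1 = 1 - (1 - p) ^ d" using assms by simp
  have less: "0 < G 1" "G 1 < 1" using G_pos[of 1] G1 assms by auto
  have "{1..m} \<inter> {l+1..n} = {l+1..m}" using assms by auto
  then have card: "card ({1..m} \<inter> {l+1..n}) = m - l" "card {1..m} = m" "card {l+1..n} = n - l"
    by auto
  have "maximal_correlation (minimum {1..m}) (minimum {l+1..n})
      = increment (m - l) 0 / sqrt (increment m 0 * increment (n - l) 0)"
    using maximal_correlation_minimum[of "{1..m}" "{l+1..n}"] less assms card by auto
  also have "\<dots> = R_min n m l (G 1)"
    using R_min_eq[OF less] assms by (simp add: increment_def G_0)
  finally show ?thesis unfolding G1 minimum_def .
qed

end
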